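(* Let $\overline h_{j+\frac12}$ and $h_j$ be the cell-average and point values of the water depth at the $n$-th time level, respectively. For the first-order scheme described in the context, if $\overline h_{j+\frac12}\ge0$ and $h_j\ge0$, then $h_j^{n+1}\ge0$, for all $j$, under the CFL condition $$\Delta t\le\frac{\Delta x}{2a_{\max}},\qquad a_{\max}=\max_j\{\alpha_{j+\frac12}\}.$$
   Context: **Setting.** One-dimensional shallow water system with water depth $h$, velocity $u$, discharge $q=hu$, bottom topography $Z(x)$, gravity constant $g$ and Manning friction coefficient $\mu$. Uniform cells $K_{j+\frac12}=[x_j,x_{j+1}]$ of size $\Delta x$ with centers $x_{j+\frac12}$; $Z_j=Z(x_j)$, $Z_{j+\frac12}=Z(x_{j+\frac12})$. At time level $n$ the data are the point values $\boldsymbol V_j=(h_j,u_j)^\top$ at $x_j$, with $q_j=h_ju_j$, and the cell averages $\overline h_{j+\frac12}$, $\overline q_{j+\frac12}$ of water depth and discharge. **Scheme.** The first-order (local Lax–Friedrichs type) scheme for the point values is $\frac{\mathrm d}{\mathrm dt}\boldsymbol V_j=-(\overleftarrow\Phi_{j+\frac12}+\overrightarrow\Phi_{j-\frac12})$ with $$\overleftarrow\Phi_{j+\frac12}=\frac1{\Delta x}\begin{pmatrix}\overline q_{j+\frac12}-q_j-\alpha_{j+\frac12}(\overline h_{j+\frac12}-h_j)\\ \overline E_{j+\frac12}-E_j-\alpha_{j+\frac12}(u_{j+\frac12}-u_j)\end{pmatrix},$$ $$\overrightarrow\Phi_{j+\frac12}=\frac1{\Delta x}\begin{pmatrix}q_{j+1}-\overline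 q_{j+\frac12}-\alpha_{j+\frac12}(\overline h_{j+\frac12}-h_{j+1})\\ E_{j+1}-\overline E_{j+\frac12}-\alpha_{j+\frac12}(u_{j+\frac12}-u_{j+1})\end{pmatrix}.$$ Here $u_{j+\frac12}=\mathfrak D(\overline q_{j+\frac12},\overline h_{j+\frac12})$, where $\mathfrak D(a,b)=a/b$ if $b\ge\varepsilon$ and $\mathfrak D(a,b)=0$ otherwise, with a small parameter $\varepsilon>0$. **Wave speed bound.** $\alpha_{j+\frac12}$ is an upper bound of the spectral radii of $J(\boldsymbol V_j)$, $J(\boldsymbol V_{j+\frac12})$ and $J(\boldsymbol V_{j+1})$, where $J(\boldsymbol V)$ is the Jacobian of the system in the variables $\boldsymbol V=(h,u)^\top$, with eigenvalues $u\pm\sqrt{gh}$; explicitly, $$\alpha_{j+\frac12}=\max\Big(|u_{j+\frac12}|+\sqrt{gh_{j+\frac12}},\ |u_j|+\sqrt{gh_j},\ |u_{j+1}|+\sqrt{gh_{j+1}}\Big),$$ where $\boldsymbol V_{j+\frac12}=(h_{j+\frac12},u_{j+\frac12})^\top$ and $h_{j+\frac12}$ is the cell-center water depth $h_{j+\frac12}=\frac32\overline h_{j+\frac12}-\frac14(h_j+h_{j+1})$. **Second component** (it does not enter the update of the water depth). $E_j=\frac{u_j^2}2+g(h_j+Z_j+Q_j)$ and $\overline E_{j+\frac12}=\frac{u_{j+\frac12}^2}{2}+g(\overline h_{j+\frac12}+Z_{j+\frac12}+\overline Q_{j+\frac12})$, where $Q_j$ is a quadrature approximation at $x_j$ of the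 global friction quantity $Q(x)=\int_{\widehat x}^{x}\mu^2h^{-10/3}|q|q\,\mathrm d\xi$ and $\overline Q_{j+\frac12}=\frac12(Q_j+Q_{j+1})$. **Time stepping.** $h_j^{n+1}$ is the point value of the water depth after one time step of size $\Delta t$. The paper's theorem does not name the time discretization; its proof treats, for brevity, the forward Euler step $h_j^{n+1}=h_j-\Delta t\,(\overleftarrow\Phi^{(1)}_{j+\frac12}+\overrightarrow\Phi^{(1)}_{j-\frac12})$ (superscript $(1)$ = first component) and remarks that positivity is retained for the three-stage third-order strong stability preserving Runge–Kutta method used in its computations, since that method is a convex combination of forward Euler steps.
   Formalization: It is additionally assumed that the average discharge is zero in every cell whose average water depth is below ε (so that average discharge = average depth times u_{j+1/2}); without this, a large discharge in a nearly dry cell makes the new depth negative. *)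

theory Defs
  imports "HOL-Analysis.Product_Vector" "Jordan_Normal_Form.Spectral_Radius"
begin

text \<open>
  Cells and nodes share the index type \<^typ>\<open>int\<close>: cell \<open>i\<close> is \<open>[x\<^sub>i, x\<^sub>i\<^sub>+\<^sub>1]\<close>, so a value
  with half-integer index \<open>i + 1/2\<close> in the literature is stored under the index \<open>i\<close>.
\<close>

record swe_params =
  grav :: real
  desing :: real               \<comment> \<open>desingularization threshold \<open>\<epsilon>\<close>\<close>
  mesh_size :: real            \<comment> \<open>\<open>\<Delta>x\<close>\<close>
  origin :: real               \<comment> \<open>position of node \<open>0\<close>\<close>
  bottom :: "real \<Rightarrow> real"      \<comment> \<open>bottom topography \<open>Z(x)\<close>\<close>

text \<open>
  The data at one time level. The values \<open>Q\<^sub>j\<close> of the global friction quantity are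
  left arbitrary, since the quadrature producing them is not specified; the friction coefficient
  enters the scheme through them only.
\<close>

record swe_data =
  depth :: "int \<Rightarrow> real"            \<comment> \<open>point values \<open>h\<^sub>j\<close>\<close>
  vel :: "int \<Rightarrow> real"              \<comment> \<open>point values \<open>u\<^sub>j\<close>\<close>
  depth_avg :: "int \<Rightarrow> real"        \<comment> \<open>cell averages of \<open>h\<close>\<close>
  discharge_avg :: "int \<Rightarrow> real"    \<comment> \<open>cell averages of \<open>q\<close>\<close>
  friction :: "int \<Rightarrow> real"         \<comment> \<open>\<open>Q\<^sub>j\<close>\<close>

definition node :: "swe_params \<Rightarrow> int \<Rightarrow> real" where
  "node P j = origin P + of_int j * mesh_size P"

definition center :: "swe_params \<Rightarrow> int \<Rightarrow> real" where
  "center P i = node P i + mesh_size P / 2"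

definition desing_quot :: "real \<Rightarrow> real \<Rightarrow> real \<Rightarrow> real" where
  "desing_quot \<epsilon> a b = (if b \<ge> \<epsilon> then a / b else 0)"

definition discharge :: "swe_data \<Rightarrow> int \<Rightarrow> real" where
  "discharge W j = depth W j * vel W j"

definition vel_center :: "swe_params \<Rightarrow> swe_data \<Rightarrow> int \<Rightarrow> real" where
  "vel_center P W i = desing_quot (desing P) (discharge_avg W i) (depth_avg W i)"

definition depth_center :: "swe_data \<Rightarrow> int \<Rightarrow> real" where
  "depth_center W i = 3 / 2 * depth_avg W i - 1 / 4 * (depth W i + depth W (i + 1))"

text \<open>
  Jacobian of the fluxes \<open>(h u, u\<^sup>2/2 + g (h + Z + Q))\<close> with respect to \<open>(h, u)\<close>, where
  \<open>Z\<close> and \<open>Q\<close> are not differentiated. It is a complex matrix because the reconstructed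
  cell-center depth may be negative, in which case the eigenvalues \<open>u \<plusminus> \<surd>(g h)\<close>
  are not real.
\<close>

definition swe_jacobian :: "real \<Rightarrow> real \<Rightarrow> real \<Rightarrow> complex mat" where
  "swe_jacobian g h u =
     mat_of_rows_list 2 [[complex_of_real u, complex_of_real h],
                         [complex_of_real g, complex_of_real u]]"

definition wave_speed :: "swe_params \<Rightarrow> swe_data \<Rightarrow> int \<Rightarrow> real" where
  "wave_speed P W i =
     max (spectral_radius (swe_jacobian (grav P) (depth_center W i) (vel_center P W i)))
    (max (spectral_radius (swe_jacobian (grav P) (depth W i) (vel W i)))
         (spectral_radius (swe_jacobian (grav P) (depth W (i + 1)) (vel W (i + 1)))))"

definition energy :: "swe_params \<Rightarrow> swe_data \<Rightarrow> int \<Rightarrow> real" where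
  "energy P W j = (vel W j)\<^sup>2 / 2
     + grav P * (depth W j + bottom P (node P j) + friction W j)"

definition energy_center :: "swe_params \<Rightarrow> swe_data \<Rightarrow> int \<Rightarrow> real" where
  "energy_center P W i = (vel_center P W i)\<^sup>2 / 2
     + grav P * (depth_avg W i + bottom P (center P i) + (friction W i + friction W (i + 1)) / 2)"

text \<open>
  The contributions of cell \<open>i\<close> to its left node \<open>i\<close> and to its right node \<open>i + 1\<close>.
\<close>

definition fluct_left :: "swe_params \<Rightarrow> swe_data \<Rightarrow> int \<Rightarrow> real \<times> real" where
  "fluct_left P W i = (1 / mesh_size P) *\<^sub>R
     (discharge_avg W i - discharge W i - wave_speed P W i * (depth_avg W i - depth W i),
      energy_center P W i - energy P W i - wave_speed P W i * (vel_center P W i - vel W i))"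

definition fluct_right :: "swe_params \<Rightarrow> swe_data \<Rightarrow> int \<Rightarrow> real \<times> real" where
  "fluct_right P W i = (1 / mesh_size P) *\<^sub>R
     (discharge W (i + 1) - discharge_avg W i
        - wave_speed P W i * (depth_avg W i - depth W (i + 1)),
      energy P W (i + 1) - energy_center P W i
        - wave_speed P W i * (vel_center P W i - vel W (i + 1)))"

definition scheme_rhs :: "swe_params \<Rightarrow> swe_data \<Rightarrow> int \<Rightarrow> real \<times> real" where
  "scheme_rhs P W j = - (fluct_left P W j + fluct_right P W (j - 1))"

definition euler_step :: "swe_params \<Rightarrow> real \<Rightarrow> swe_data \<Rightarrow> int \<Rightarrow> real \<times> real" where
  "euler_step P \<Delta>t W j = (depth W j, vel W j) + \<Delta>t *\<^sub>R scheme_rhs P W j"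

definition new_depth :: "swe_params \<Rightarrow> real \<Rightarrow> swe_data \<Rightarrow> int \<Rightarrow> real" where
  "new_depth P \<Delta>t W j = fst (euler_step P \<Delta>t W j)"

lemma spectrum_swe_jacobian:
  "spectrum (swe_jacobian g h u) = {k. (k - of_real u)\<^sup>2 = of_real (g * h)}"
proof -
  let ?A = "swe_jacobian g h u"
  have A: "?A \<in> carrier_mat 2 2"
    by (simp add: swe_jacobian_def mat_of_rows_list_def numeral_2_eq_2)
  have c: "char_matrix ?A k \<in> carrier_mat 2 2" for k
    using A by (simp add: char_matrix_def)
  have d: "det (char_matrix ?A k) = (of_real u - k)\<^sup>2 - of_real (g * h)" for k
    unfolding laplace_expansion_column[OF c, of 0, simplified]
    by (simp add: cofactor_def mat_delete_def char_matrix_def swe_jacobian_def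
        mat_of_rows_list_def numeral_2_eq_2 det_single power2_eq_square algebra_simps)
  show ?thesis
    unfolding spectrum_def using eigenvalue_det[OF A] d
    by (auto simp: power2_commute)
qed

lemma spectral_radius_swe_jacobian:
  assumes "g \<ge> 0" "h \<ge> 0"
  shows "spectral_radius (swe_jacobian g h u) = \<bar>u\<bar> + sqrt (g * h)"
proof -
  let ?s = "sqrt (g * h)"
  have s: "?s \<ge> 0" "?s\<^sup>2 = g * h" using assms by auto
  have "(k - of_real u)\<^sup>2 = of_real (g * h) \<longleftrightarrow> k = of_real (u + ?s) \<or> k = of_real (u - ?s)"
    for k :: complex
  proof -
    have "(k - of_real u)\<^sup>2 = of_real (g * h) \<longleftrightarrow> (k - of_real u)\<^sup>2 = (of_real ?s :: complex)\<^sup>2"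
      using s by (metis of_real_power)
    also have "\<dots> \<longleftrightarrow> k = of_real (u + ?s) \<or> k = of_real (u - ?s)"
      unfolding power2_eq_iff by (auto simp: algebra_simps)
    finally show ?thesis .
  qed
  then have "spectrum (swe_jacobian g h u) = {of_real (u + ?s), of_real (u - ?s)}"
    unfolding spectrum_swe_jacobian by blast
  then have "spectral_radius (swe_jacobian g h u) = max \<bar>u + ?s\<bar> \<bar>u - ?s\<bar>"
    unfolding spectral_radius_def by (simp del: of_real_add of_real_diff)
  also have "\<dots> = \<bar>u\<bar> + ?s" using s(1) by linarith
  finally show ?thesis .
qed

lemma wave_speed_explicit:
  assumes "grav P \<ge> 0" "depth_center W i \<ge> 0" "depth W i \<ge> 0" "depth W (i + 1) \<ge> 0"
  shows "wave_speed P W i =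
     max (\<bar>vel_center P W i\<bar> + sqrt (grav P * depth_center W i))
    (max (\<bar>vel W i\<bar> + sqrt (grav P * depth W i))
         (\<bar>vel W (i + 1)\<bar> + sqrt (grav P * depth W (i + 1))))"
  using assms by (simp add: wave_speed_def spectral_radius_swe_jacobian)

end

(*
  Writing lambda = dt / dx, the Euler update of the depth is the combination
    (1 - lambda (alpha_j + alpha_(j-1))) h_j
      + lambda (alpha_j hbar_j - qbar_j) + lambda (alpha_(j-1) hbar_(j-1) + qbar_(j-1)).
  The first coefficient is nonnegative by the CFL condition. The other two terms are nonnegative
  because qbar = hbar u with |u| <= alpha. This bound on u holds even if the reconstructed
  cell-center depth is negative: the eigenvalues are then u +- i sqrt(- g h), with real part u.
*)
theory Submission
  imports Defs
begin

lemma abs_le_spectral_radius_swe_jacobian: "\<bar>u\<bar> \<le> spectral_radius (swe_jacobian g h u)"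
proof -
  let ?A = "swe_jacobian g h u"
  define r where "r = csqrt (of_real (g * h))"
  \<comment> \<open>The principal root has \<open>Re r\<close> \<ge> 0 whatever the sign of
    \<open>g * h\<close>. Giving it the sign of \<open>u\<close> keeps the real parts from
    cancelling.\<close>
  define k where "k = of_real u + (if u \<ge> 0 then r else - r)"
  have "r\<^sup>2 = of_real (g * h)"
    by (simp add: r_def del: of_real_mult)
  then have k: "k \<in> spectrum ?A"
    by (simp add: spectrum_swe_jacobian k_def)
  have A: "?A \<in> carrier_mat 2 2"
    by (simp add: swe_jacobian_def mat_of_rows_list_def numeral_2_eq_2)
  have "Re r \<ge> 0"
    using csqrt_principal[of "of_real (g * h)"] by (auto simp: r_def)
  then have "\<bar>u\<bar> \<le> \<bar>Re k\<bar>"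
    by (auto simp: k_def)
  also have "\<dots> \<le> cmod k"
    by (rule abs_Re_le_cmod)
  also have "\<dots> \<le> spectral_radius ?A"
    using spectral_radius_mem_max(2)[OF A] k by auto
  finally show ?thesis .
qed

lemma abs_vel_center_le_wave_speed: "\<bar>vel_center P W i\<bar> \<le> wave_speed P W i"
  unfolding wave_speed_def
  using abs_le_spectral_radius_swe_jacobian by (meson max.cobounded1 order_trans)

lemma wave_speed_nonneg: "0 \<le> wave_speed P W i"
  using abs_vel_center_le_wave_speed[of P W i] by linarith

text \<open>At or above the threshold the division by a positive depth can be undone. Below it
  \<open>desing_quot\<close> returns 0, so the velocity recovers the discharge only if that vanishes
  too.\<close>

lemma abs_discharge_avg_le:
  assumes "desing P > 0" "depth_avg W i \<ge> 0"
    and "depth_avg W i < desing P \<Longrightarrow> discharge_avg W i = 0"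
  shows "\<bar>discharge_avg W i\<bar> \<le> wave_speed P W i * depth_avg W i"
proof -
  have "discharge_avg W i = vel_center P W i * depth_avg W i"
    using assms by (auto simp: vel_center_def desing_quot_def)
  then show ?thesis
    using assms(2) abs_vel_center_le_wave_speed[of P W i]
    by (simp add: abs_mult mult_right_mono)
qed

text \<open>The nodal discharge \<open>discharge W j\<close> enters the two fluctuations with
  opposite signs and cancels, leaving only cell averages of the discharge.\<close>

lemma new_depth_eq:
  "new_depth P \<Delta>t W j =
     (1 - \<Delta>t / mesh_size P * (wave_speed P W j + wave_speed P W (j - 1))) * depth W j
     + \<Delta>t / mesh_size P * (wave_speed P W j * depth_avg W j - discharge_avg W j)
     + \<Delta>t / mesh_size P *
         (wave_speed P W (j - 1) * depth_avg W (j - 1) + discharge_avg W (j - 1))"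
  \<comment> \<open>With mesh size 0, division by zero gives 0 and both sides are
    \<open>depth W j\<close>.\<close>
  by (cases "mesh_size P = 0")
    (simp_all add: new_depth_def euler_step_def scheme_rhs_def fluct_left_def fluct_right_def
      field_simps)

theorem theorem2p2:
  fixes P :: swe_params and W :: swe_data and cells :: "int set" and a_max \<Delta>t :: real
  assumes "grav P > 0" and "desing P > 0" and "mesh_size P > 0" and "\<Delta>t > 0"
    and "\<And>i. i \<in> cells \<Longrightarrow> depth_avg W i \<ge> 0"
    and "\<And>i. i \<in> cells \<Longrightarrow> depth W i \<ge> 0 \<and> depth W (i + 1) \<ge> 0"
    and "\<And>i. i \<in> cells \<Longrightarrow> depth_avg W i < desing P \<Longrightarrow> discharge_avg W i = 0"
    and "bdd_above (wave_speed P W ` cells)"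
    and "a_max = (SUP i\<in>cells. wave_speed P W i)"
    and "a_max > 0 \<longrightarrow> \<Delta>t \<le> mesh_size P / (2 * a_max)"
  shows "\<forall>j. j - 1 \<in> cells \<and> j \<in> cells \<longrightarrow> new_depth P \<Delta>t W j \<ge> 0"
proof (intro allI impI)
  fix j
  assume j: "j - 1 \<in> cells \<and> j \<in> cells"
  let ?\<alpha> = "wave_speed P W" and ?c = "\<Delta>t / mesh_size P"
  have \<alpha>_le: "?\<alpha> i \<le> a_max" if "i \<in> cells" for i
    unfolding assms(9) using that assms(8) by (rule cSUP_upper)
  have c_nonneg: "?c \<ge> 0" using assms(3,4) by simp
  \<comment> \<open>Two cells meet at node \<open>j\<close>, hence the factor 2 in the CFL
    bound.\<close>
  have "?c * (?\<alpha> j + ?\<alpha> (j - 1)) \<le> ?c * (2 * a_max)"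
    using c_nonneg \<alpha>_le[of j] \<alpha>_le[of "j - 1"] j by (intro mult_left_mono) auto
  also have "\<dots> \<le> 1"
  proof (cases "a_max > 0")
    case True
    with assms(3,10) show ?thesis by (simp add: field_simps)
  next
    case False
    \<comment> \<open>Here the CFL hypothesis is vacuous, but nonnegative wave speeds force
      \<open>a_max = 0\<close>.\<close>
    with \<alpha>_le[of j] j wave_speed_nonneg[of P W j] have "a_max = 0" by simp
    then show ?thesis by simp
  qed
  finally have cfl: "?c * (?\<alpha> j + ?\<alpha> (j - 1)) \<le> 1" .
  have q: "\<bar>discharge_avg W i\<bar> \<le> ?\<alpha> i * depth_avg W i" if "i \<in> cells" for i
    using assms(2) assms(5)[OF that] assms(7)[OF that] by (rule abs_discharge_avg_le)
  have "0 \<le> ?\<alpha> j * depth_avg W j - discharge_avg W j"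
    and "0 \<le> ?\<alpha> (j - 1) * depth_avg W (j - 1) + discharge_avg W (j - 1)"
    using j q[of j] q[of "j - 1"] by auto
  moreover have "0 \<le> 1 - ?c * (?\<alpha> j + ?\<alpha> (j - 1))" "0 \<le> depth W j"
    using cfl j assms(6) by auto
  ultimately show "new_depth P \<Delta>t W j \<ge> 0"
    unfolding new_depth_eq using c_nonneg
    by (meson add_nonneg_nonneg mult_nonneg_nonneg)
qed

end
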